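(* Let $\xi: X\to E\overset{p}{\to}Y$ be a fibration of CW complexes, let $f:Y'\to Y$ be a map, and let $f^*\xi: X\to E'\to Y'$ be the pull-back fibration of $\xi$ along $f$. Then there is an inclusion $$G^{\xi}_n(X)\subset G^{f^*\xi}_n(X)$$ for all $n>0$.
   Context: For a space $X$, $aut_1(X)$ denotes the identity component of the space of unpointed homotopy self-equivalences of $X$, and $ev_X: aut_1(X)\to X$ is evaluation at the base point. For a fibration $\xi: X\overset{j}{\to}E\overset{p}{\to}Y$ (with $X$ the fibre over the base point), $aut(p)$ is the space of unpointed fibre-homotopy self-equivalences $g:E\to E$ with $p\circ g=p$, and $aut_1(p)$ is its identity component. Restriction to the fibre gives a map $R:aut_1(p)\to aut_1(X)$. The $n$-th fibre-restricted Gottlieb group of $X$ with respect to $\xi$ is the subgroup $G^{\xi}_n(X):=\mathrm{Im}\,(\pi_n(ev_X\circ R):\pi_n(aut_1(p))\to\pi_n(X))$ of $\pi_n(X)$. Maps between bases are base point preserving, so that the fibre of $f^*\xi$ over the base point of $Y'$ is identified with the fibre $X$ of $\xi$. *)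

theory Defs
  imports "HOL-Analysis.Analysis" "HOL-Algebra.Group"
begin

section \<open>CW complexes\<close>

definition cw_disc :: "nat \<Rightarrow> (nat \<Rightarrow> real) topology" where
  "cw_disc n = subtopology (Euclidean_space n) {x. (\<Sum>i<n. (x i)\<^sup>2) \<le> 1}"

definition cw_open_ball :: "nat \<Rightarrow> (nat \<Rightarrow> real) set" where
  "cw_open_ball n = {x \<in> topspace (Euclidean_space n). (\<Sum>i<n. (x i)\<^sup>2) < 1}"

definition cw_bounding_sphere :: "nat \<Rightarrow> (nat \<Rightarrow> real) set" where
  "cw_bounding_sphere n = {x \<in> topspace (Euclidean_space n). (\<Sum>i<n. (x i)\<^sup>2) = 1}"

definition open_cell :: "nat \<times> ((nat \<Rightarrow> real) \<Rightarrow> 'a) \<Rightarrow> 'a set" where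
  "open_cell c = snd c ` cw_open_ball (fst c)"

text \<open>Whitehead's definition. A cell is recorded as a pair of its dimension and its characteristic
  map. Open cells are nonempty and pairwise disjoint, so no cell is counted twice.
  Since \<^term>\<open>X\<close> is Hausdorff and the disc is compact, a characteristic map which is injective on the
  open ball and maps the bounding sphere into other cells is a homeomorphism from the open ball
  onto the open cell.\<close>

definition CW_structure :: "'a topology \<Rightarrow> (nat \<times> ((nat \<Rightarrow> real) \<Rightarrow> 'a)) set \<Rightarrow> bool" where
  "CW_structure X C \<longleftrightarrow>
     Hausdorff_space X \<and>
     (\<forall>(n, \<phi>) \<in> C. continuous_map (cw_disc n) X \<phi> \<and> inj_on \<phi> (cw_open_ball n)) \<and>
     pairwise (\<lambda>c d. disjnt (open_cell c) (open_cell d)) C \<and>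
     (\<Union>c\<in>C. open_cell c) = topspace X \<and>
     (\<forall>(n, \<phi>) \<in> C. \<exists>D. finite D \<and> D \<subseteq> C \<and> (\<forall>d\<in>D. fst d < n) \<and>
        \<phi> ` cw_bounding_sphere n \<subseteq> (\<Union>d\<in>D. open_cell d)) \<and>
     (\<forall>A. A \<subseteq> topspace X \<and>
        (\<forall>(n, \<phi>) \<in> C. closedin (cw_disc n) {x \<in> topspace (cw_disc n). \<phi> x \<in> A}) \<longrightarrow>
        closedin X A)"

definition CW_complex :: "'a topology \<Rightarrow> bool" where
  "CW_complex X \<longleftrightarrow> (\<exists>C. CW_structure X C)"


section \<open>Spaces of maps\<close>

text \<open>The compact-open topology on the continuous maps from \<^term>\<open>X\<close> to \<^term>\<open>Y\<close>. So that
  there is one point per map, points are functions that are \<^term>\<open>undefined\<close> outside the space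
  \<^term>\<open>X\<close>.\<close>

definition mapping_space :: "'a topology \<Rightarrow> 'b topology \<Rightarrow> ('a \<Rightarrow> 'b) topology" where
  "mapping_space X Y = topology_generated_by
     {{f \<in> extensional (topspace X). continuous_map X Y f \<and> f ` K \<subseteq> U} | K U.
        compactin X K \<and> openin Y U}"

abbreviation id_map :: "'a topology \<Rightarrow> 'a \<Rightarrow> 'a" where
  "id_map X \<equiv> (\<lambda>x\<in>topspace X. x)"

definition aut :: "'a topology \<Rightarrow> ('a \<Rightarrow> 'a) topology" where
  "aut X = subtopology (mapping_space X X)
     {g. \<exists>h. continuous_map X X h \<and>
         homotopic_with (\<lambda>_. True) X X (h \<circ> g) id \<and> homotopic_with (\<lambda>_. True) X X (g \<circ> h) id}"

definition aut1 :: "'a topology \<Rightarrow> ('a \<Rightarrow> 'a) topology" where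
  "aut1 X = subtopology (aut X) (Collect (path_component_of (aut X) (id_map X)))"

definition over_base :: "'e topology \<Rightarrow> ('e \<Rightarrow> 'y) \<Rightarrow> ('e \<Rightarrow> 'e) \<Rightarrow> bool" where
  "over_base E p g \<longleftrightarrow> (\<forall>e\<in>topspace E. p (g e) = p e)"

definition aut_over :: "'e topology \<Rightarrow> ('e \<Rightarrow> 'y) \<Rightarrow> ('e \<Rightarrow> 'e) topology" where
  "aut_over E p = subtopology (mapping_space E E)
     {g. over_base E p g \<and>
         (\<exists>h. continuous_map E E h \<and> over_base E p h \<and>
            homotopic_with (over_base E p) E E (h \<circ> g) id \<and>
            homotopic_with (over_base E p) E E (g \<circ> h) id)}"

definition aut1_over :: "'e topology \<Rightarrow> ('e \<Rightarrow> 'y) \<Rightarrow> ('e \<Rightarrow> 'e) topology" where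
  "aut1_over E p =
     subtopology (aut_over E p) (Collect (path_component_of (aut_over E p) (id_map E)))"


section \<open>Homotopy groups\<close>

definition cube :: "nat \<Rightarrow> (nat \<Rightarrow> real) topology" where
  "cube n = product_topology (\<lambda>_. top_of_set {0..1}) {..<n}"

definition cube_boundary :: "nat \<Rightarrow> (nat \<Rightarrow> real) set" where
  "cube_boundary n = {s \<in> topspace (cube n). \<exists>i<n. s i = 0 \<or> s i = 1}"

definition sends_boundary :: "nat \<Rightarrow> 'a \<Rightarrow> ((nat \<Rightarrow> real) \<Rightarrow> 'a) \<Rightarrow> bool" where
  "sends_boundary n a f \<longleftrightarrow> (\<forall>s\<in>cube_boundary n. f s = a)"

definition spheroid :: "nat \<Rightarrow> 'a topology \<Rightarrow> 'a \<Rightarrow> ((nat \<Rightarrow> real) \<Rightarrow> 'a) \<Rightarrow> bool" where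
  "spheroid n A a f \<longleftrightarrow> continuous_map (cube n) A f \<and> sends_boundary n a f"

definition spheroid_class ::
    "nat \<Rightarrow> 'a topology \<Rightarrow> 'a \<Rightarrow> ((nat \<Rightarrow> real) \<Rightarrow> 'a) \<Rightarrow> ((nat \<Rightarrow> real) \<Rightarrow> 'a) set" where
  "spheroid_class n A a f = {g. homotopic_with (sends_boundary n a) (cube n) A f g}"

definition spheroid_concat ::
    "((nat \<Rightarrow> real) \<Rightarrow> 'a) \<Rightarrow> ((nat \<Rightarrow> real) \<Rightarrow> 'a) \<Rightarrow> (nat \<Rightarrow> real) \<Rightarrow> 'a" where
  "spheroid_concat f g s =
     (if s 0 \<le> 1/2 then f (s(0 := 2 * s 0)) else g (s(0 := 2 * s 0 - 1)))"

text \<open>Intended for \<^term>\<open>n > 0\<close> and \<^term>\<open>a \<in> topspace A\<close>.\<close>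

definition homotopy_group ::
    "nat \<Rightarrow> 'a topology \<Rightarrow> 'a \<Rightarrow> ((nat \<Rightarrow> real) \<Rightarrow> 'a) set monoid" where
  "homotopy_group n A a =
     \<lparr>carrier = spheroid_class n A a ` Collect (spheroid n A a),
      mult = (\<lambda>c d. \<Union>f\<in>c. \<Union>g\<in>d. spheroid_class n A a (spheroid_concat f g)),
      one = spheroid_class n A a (\<lambda>_. a)\<rparr>"

definition homotopy_group_map ::
    "nat \<Rightarrow> 'b topology \<Rightarrow> 'b \<Rightarrow> ('a \<Rightarrow> 'b) \<Rightarrow> ((nat \<Rightarrow> real) \<Rightarrow> 'a) set \<Rightarrow> ((nat \<Rightarrow> real) \<Rightarrow> 'b) set"
    where
  "homotopy_group_map n B b \<phi> c = (\<Union>f\<in>c. spheroid_class n B b (\<phi> \<circ> f))"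


section \<open>Fibrations and pull-backs\<close>

definition homotopy_lifting_property ::
    "'z topology \<Rightarrow> 'e topology \<Rightarrow> 'y topology \<Rightarrow> ('e \<Rightarrow> 'y) \<Rightarrow> bool" where
  "homotopy_lifting_property Z E Y p \<longleftrightarrow>
     (\<forall>f h. continuous_map Z E f \<and> continuous_map (prod_topology (top_of_set {0..1::real}) Z) Y h \<and>
        (\<forall>z\<in>topspace Z. h (0, z) = p (f z)) \<longrightarrow>
        (\<exists>k. continuous_map (prod_topology (top_of_set {0..1::real}) Z) E k \<and>
           (\<forall>z\<in>topspace Z. k (0, z) = f z) \<and>
           (\<forall>t\<in>{0..1}. \<forall>z\<in>topspace Z. p (k (t, z)) = h (t, z))))"

text \<open>A Hurewicz fibration has the homotopy lifting property for all spaces. A definition cannot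
  quantify over types, so the test spaces range over all topologies on the one type that
  carries the mapping path space of \<^term>\<open>p\<close>; lemma \<open>hurewicz_fibration_lifting\<close> below shows that
  this yields the property for test spaces of every type.\<close>

definition hurewicz_fibration :: "'e topology \<Rightarrow> 'y topology \<Rightarrow> ('e \<Rightarrow> 'y) \<Rightarrow> bool" where
  "hurewicz_fibration E Y p \<longleftrightarrow>
     continuous_map E Y p \<and>
     (\<forall>Z :: ('e \<times> (real \<Rightarrow> 'y)) topology. homotopy_lifting_property Z E Y p)"

text \<open>The fibre is given as a space \<^term>\<open>X\<close> with an embedding \<^term>\<open>j\<close> onto the preimage of the base
  point, so that a fibration and its pull-back have literally the same fibre.\<close>

definition fibration_sequence ::
    "'x topology \<Rightarrow> ('x \<Rightarrow> 'e) \<Rightarrow> 'e topology \<Rightarrow> ('e \<Rightarrow> 'y) \<Rightarrow> 'y topology \<Rightarrow> 'y \<Rightarrow> bool" where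
  "fibration_sequence X j E p Y y0 \<longleftrightarrow>
     hurewicz_fibration E Y p \<and> y0 \<in> topspace Y \<and>
     embedding_map X E j \<and> j ` topspace X = {e \<in> topspace E. p e = y0}"

definition pullback_space ::
    "'b topology \<Rightarrow> ('b \<Rightarrow> 'y) \<Rightarrow> 'e topology \<Rightarrow> ('e \<Rightarrow> 'y) \<Rightarrow> ('b \<times> 'e) topology" where
  "pullback_space Y' f E p = subtopology (prod_topology Y' E) {(b, e). f b = p e}"


section \<open>Fibre-restricted Gottlieb groups\<close>

definition fibre_restriction :: "'x topology \<Rightarrow> ('x \<Rightarrow> 'e) \<Rightarrow> ('e \<Rightarrow> 'e) \<Rightarrow> 'x \<Rightarrow> 'x" where
  "fibre_restriction X j g = (\<lambda>x\<in>topspace X. inv_into (topspace X) j (g (j x)))"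

definition evaluation :: "'x \<Rightarrow> ('x \<Rightarrow> 'x) \<Rightarrow> 'x" where
  "evaluation x0 g = g x0"

definition fibre_restricted_gottlieb ::
    "nat \<Rightarrow> 'x topology \<Rightarrow> 'x \<Rightarrow> ('x \<Rightarrow> 'e) \<Rightarrow> 'e topology \<Rightarrow> ('e \<Rightarrow> 'y) \<Rightarrow> ((nat \<Rightarrow> real) \<Rightarrow> 'x) set set"
    where
  "fibre_restricted_gottlieb n X x0 j E p =
     homotopy_group_map n X x0 (evaluation x0 \<circ> fibre_restriction X j) `
       carrier (homotopy_group n (aut1_over E p) (id_map E))"


section \<open>Consistency of the definitions\<close>

lemma topspace_mapping_space:
  "topspace (mapping_space X Y) = {f \<in> extensional (topspace X). continuous_map X Y f}"
proof -
  have "\<exists>K U. compactin X K \<and> openin Y U \<and> f ` K \<subseteq> U" for f :: "'a \<Rightarrow> 'b"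
    by (rule exI[of _ "{}"]) auto
  then show ?thesis
    unfolding mapping_space_def topology_generated_by_topspace by blast
qed

lemma continuous_map_curry:
  assumes h: "continuous_map (prod_topology A X) Y h"
  shows "continuous_map A (mapping_space X Y) (\<lambda>a. \<lambda>x\<in>topspace X. h (a, x))"
proof -
  have cont: "continuous_map X Y (\<lambda>x\<in>topspace X. h (a, x))" if "a \<in> topspace A" for a
  proof -
    have "continuous_map X Y (h \<circ> (\<lambda>x. (a, x)))"
      by (rule continuous_map_compose[OF _ h]) (auto simp: continuous_map_pairwise o_def that)
    then show ?thesis
      by (rule continuous_map_eq) auto
  qed
  show ?thesis
    unfolding mapping_space_def
  proof (rule continuous_on_generated_topo)
    fix W
    assume "W \<in> {{f \<in> extensional (topspace X). continuous_map X Y f \<and> f ` K \<subseteq> U} | K U.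
        compactin X K \<and> openin Y U}"
    then obtain K U where K: "compactin X K" and U: "openin Y U"
      and W: "W = {f \<in> extensional (topspace X). continuous_map X Y f \<and> f ` K \<subseteq> U}"
      by blast
    have KX: "K \<subseteq> topspace X"
      using K compactin_subset_topspace by blast
    let ?P = "{q \<in> topspace (prod_topology A X). h q \<in> U}"
    have P: "openin (prod_topology A X) ?P"
      using h U openin_continuous_map_preimage by blast
    have eq: "(\<lambda>a. \<lambda>x\<in>topspace X. h (a, x)) -` W \<inter> topspace A =
        {a \<in> topspace A. {a} \<times> K \<subseteq> ?P}"
      using KX cont by (auto simp: W subset_iff image_subset_iff)
    show "openin A ((\<lambda>a. \<lambda>x\<in>topspace X. h (a, x)) -` W \<inter> topspace A)"
      unfolding eq
    proof (rule openin_subopen[THEN iffD2], rule ballI)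
      fix a assume "a \<in> {a \<in> topspace A. {a} \<times> K \<subseteq> ?P}"
      then have a: "a \<in> topspace A" "{a} \<times> K \<subseteq> ?P"
        by blast+
      have aA: "compactin A {a}"
        using a by simp
      obtain V V' where V: "openin A V" "openin X V'" "{a} \<subseteq> V" "K \<subseteq> V'" "V \<times> V' \<subseteq> ?P"
        by (rule Wallace_theorem_prod_topology[OF aA K P a(2)])
      have "V \<subseteq> {a \<in> topspace A. {a} \<times> K \<subseteq> ?P}"
        using openin_subset[OF V(1)] V(4,5) by blast
      then show "\<exists>T. openin A T \<and> a \<in> T \<and> T \<subseteq> {a \<in> topspace A. {a} \<times> K \<subseteq> ?P}"
        using V by blast
    qed
  next
    show "(\<lambda>a. \<lambda>x\<in>topspace X. h (a, x)) ` topspace A \<subseteq>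
        \<Union> {{f \<in> extensional (topspace X). continuous_map X Y f \<and> f ` K \<subseteq> U} | K U.
          compactin X K \<and> openin Y U}"
      unfolding topology_generated_by_topspace[symmetric] mapping_space_def[symmetric]
        topspace_mapping_space
      using cont by auto
  qed
qed

lemma continuous_map_path_evaluation:
  "continuous_map (prod_topology (top_of_set {0..1::real}) (mapping_space (top_of_set {0..1::real}) Y))
     Y (\<lambda>(t, \<gamma>). \<gamma> t)"
proof -
  let ?I = "top_of_set {0..1::real}"
  show ?thesis
    unfolding continuous_map_def
  proof (intro conjI allI impI)
    show "(\<lambda>(t, \<gamma>). \<gamma> t) \<in> topspace (prod_topology ?I (mapping_space ?I Y)) \<rightarrow> topspace Y"
      by (auto simp: topspace_mapping_space continuous_map_def)
  next
    fix U assume U: "openin Y U"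
    show "openin (prod_topology ?I (mapping_space ?I Y))
        {x \<in> topspace (prod_topology ?I (mapping_space ?I Y)). (case x of (t, \<gamma>) \<Rightarrow> \<gamma> t) \<in> U}"
    proof (rule openin_subopen[THEN iffD2], clarify)
      fix t \<gamma>
      assume t: "(t, \<gamma>) \<in> topspace (prod_topology ?I (mapping_space ?I Y))" and tU: "\<gamma> t \<in> U"
      then have \<gamma>: "continuous_map ?I Y \<gamma>" "\<gamma> \<in> extensional {0..1}" and t01: "t \<in> {0..1}"
        by (auto simp: topspace_mapping_space)
      have "openin ?I {s \<in> topspace ?I. \<gamma> s \<in> U}"
        using \<gamma> U openin_continuous_map_preimage by blast
      then obtain d where d: "d > 0" "\<And>s. s \<in> {0..1} \<Longrightarrow> dist s t < d \<Longrightarrow> \<gamma> s \<in> U"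
        using t01 tU unfolding openin_euclidean_subtopology_iff topspace_euclidean_subtopology
        by (metis (no_types, lifting) mem_Collect_eq)
      let ?K = "{0..1} \<inter> cball t (d/2)"
      let ?V = "{0..1} \<inter> ball t (d/2)"
      let ?W = "{f \<in> extensional (topspace ?I). continuous_map ?I Y f \<and> f ` ?K \<subseteq> U}"
      have K: "compactin ?I ?K"
        by (simp add: compactin_subtopology compact_Int)
      have W: "openin (mapping_space ?I Y) ?W"
        unfolding mapping_space_def
        by (rule topology_generated_by_Basis) (use K U in blast)
      have V: "openin ?I ?V"
        by (simp add: openin_open_Int)
      have "\<gamma> \<in> ?W"
        using \<gamma> d by (auto simp: dist_commute)
      moreover have "t \<in> ?V"
        using t01 d by simp
      moreover have "?V \<times> ?W \<subseteq>
          {x \<in> topspace (prod_topology ?I (mapping_space ?I Y)). (case x of (t, \<gamma>) \<Rightarrow> \<gamma> t) \<in> U}"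
        by (auto simp: topspace_mapping_space image_subset_iff)
      ultimately show "\<exists>T. openin (prod_topology ?I (mapping_space ?I Y)) T \<and> (t, \<gamma>) \<in> T \<and> T \<subseteq>
          {x \<in> topspace (prod_topology ?I (mapping_space ?I Y)). (case x of (t, \<gamma>) \<Rightarrow> \<gamma> t) \<in> U}"
        using V W by (intro exI[of _ "?V \<times> ?W"]) (simp add: openin_prod_Times_iff)
    qed
  qed
qed

lemma hurewicz_fibration_lifting:
  fixes E :: "'e topology" and Y :: "'y topology" and Z :: "'z topology"
  assumes fib: "hurewicz_fibration E Y p"
  shows "homotopy_lifting_property Z E Y p"
  unfolding homotopy_lifting_property_def
proof (intro allI impI, elim conjE)
  fix f h
  let ?I = "top_of_set {0..1::real}"
  assume f: "continuous_map Z E f" and h: "continuous_map (prod_topology ?I Z) Y h"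
    and start: "\<forall>z\<in>topspace Z. h (0, z) = p (f z)"
  define N where "N = subtopology (prod_topology E (mapping_space ?I Y)) {(e, \<gamma>). \<gamma> 0 = p e}"
  have "homotopy_lifting_property N E Y p"
    using fib unfolding hurewicz_fibration_def by blast
  moreover have fst: "continuous_map N E fst"
    unfolding N_def by (simp add: continuous_map_from_subtopology continuous_map_fst)
  moreover have ev: "continuous_map (prod_topology ?I N) Y (\<lambda>(t, q). snd q t)"
  proof -
    have "continuous_map (prod_topology ?I N) (prod_topology ?I (mapping_space ?I Y))
        (\<lambda>(t, q). (t, snd q))"
      unfolding N_def
      by (auto simp: continuous_map_pairwise o_def case_prod_unfold continuous_map_fst
          intro!: continuous_map_compose[OF continuous_map_snd, unfolded o_def]
            continuous_map_from_subtopology continuous_map_snd)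
    from continuous_map_compose[OF this continuous_map_path_evaluation]
    show ?thesis
      by (simp add: o_def case_prod_unfold)
  qed
  moreover have "\<forall>q\<in>topspace N. (case (0, q) of (t, q) \<Rightarrow> snd q t) = p (fst q)"
    by (auto simp: N_def)
  ultimately obtain k where k: "continuous_map (prod_topology ?I N) E k"
    "\<forall>q\<in>topspace N. k (0, q) = fst q"
    "\<forall>t\<in>{0..1}. \<forall>q\<in>topspace N. p (k (t, q)) = snd q t"
    unfolding homotopy_lifting_property_def by (smt (verit, best) case_prod_conv)
  define \<phi> where "\<phi> z = (f z, \<lambda>t\<in>{0..1}. h (t, z))" for z
  have swap: "continuous_map (prod_topology Z ?I) Y (h \<circ> prod.swap)"
    by (rule continuous_map_compose[OF _ h])
      (auto simp: continuous_map_pairwise o_def continuous_map_fst continuous_map_snd)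
  have \<phi>: "continuous_map Z N \<phi>"
    unfolding N_def
  proof (rule continuous_map_into_subtopology)
    show "continuous_map Z (prod_topology E (mapping_space ?I Y)) \<phi>"
      using continuous_map_curry[OF swap] f
      by (simp add: continuous_map_pairwise o_def \<phi>_def)
    show "\<phi> \<in> topspace Z \<rightarrow> {(e, \<gamma>). \<gamma> 0 = p e}"
      using start by (auto simp: \<phi>_def)
  qed
  show "\<exists>k. continuous_map (prod_topology ?I Z) E k \<and> (\<forall>z\<in>topspace Z. k (0, z) = f z) \<and>
      (\<forall>t\<in>{0..1}. \<forall>z\<in>topspace Z. p (k (t, z)) = h (t, z))"
  proof (intro exI conjI ballI)
    have "continuous_map (prod_topology ?I Z) (prod_topology ?I N) (\<lambda>(t, z). (t, \<phi> z))"
      by (auto simp: continuous_map_pairwise o_def case_prod_unfold continuous_map_fst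
          intro!: continuous_map_compose[OF continuous_map_snd \<phi>, unfolded o_def])
    then show "continuous_map (prod_topology ?I Z) E (k \<circ> (\<lambda>(t, z). (t, \<phi> z)))"
      using k(1) continuous_map_compose by blast
  next
    fix z assume z: "z \<in> topspace Z"
    then have N: "\<phi> z \<in> topspace N"
      using \<phi> by (auto simp: continuous_map_def)
    show "(k \<circ> (\<lambda>(t, z). (t, \<phi> z))) (0, z) = f z"
      using k(2) N by (simp add: \<phi>_def)
    show "p ((k \<circ> (\<lambda>(t, z). (t, \<phi> z))) (t, z)) = h (t, z)" if "t \<in> {0..1}" for t
      using k(3) N that by (simp add: \<phi>_def)
  qed
qed

lemma topspace_pullback_space:
  "topspace (pullback_space Y' f E p) = {(b, e). b \<in> topspace Y' \<and> e \<in> topspace E \<and> f b = p e}"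
  by (auto simp: pullback_space_def)

lemma hurewicz_fibration_pullback:
  assumes fib: "hurewicz_fibration E Y p" and f: "continuous_map Y' Y f"
  shows "hurewicz_fibration (pullback_space Y' f E p) Y' fst"
  unfolding hurewicz_fibration_def homotopy_lifting_property_def
proof (intro conjI allI impI, goal_cases)
  case 1
  show ?case
    unfolding pullback_space_def by (simp add: continuous_map_from_subtopology continuous_map_fst)
next
  let ?I = "top_of_set {0..1::real}"
  case (2 Z g h)
  then have g: "continuous_map Z (pullback_space Y' f E p) g"
    and h: "continuous_map (prod_topology ?I Z) Y' h"
    and start: "\<forall>z\<in>topspace Z. h (0, z) = fst (g z)"
    by auto
  have gE: "continuous_map Z E (snd \<circ> g)"
    using g unfolding pullback_space_def continuous_map_in_subtopology
    by (auto simp: continuous_map_pairwise)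
  have gp: "f (fst (g z)) = p (snd (g z))" if "z \<in> topspace Z" for z
    using g that by (auto simp: continuous_map_def topspace_pullback_space Pi_iff case_prod_unfold)
  have "continuous_map (prod_topology ?I Z) Y (f \<circ> h)"
    using h f continuous_map_compose by blast
  moreover have "\<forall>z\<in>topspace Z. (f \<circ> h) (0, z) = p ((snd \<circ> g) z)"
    using start gp by simp
  ultimately obtain k where k: "continuous_map (prod_topology ?I Z) E k"
    "\<forall>z\<in>topspace Z. k (0, z) = (snd \<circ> g) z"
    "\<forall>t\<in>{0..1}. \<forall>z\<in>topspace Z. p (k (t, z)) = (f \<circ> h) (t, z)"
    using hurewicz_fibration_lifting[OF fib, of Z] gE
    unfolding homotopy_lifting_property_def by blast
  show ?case
  proof (intro exI conjI ballI)
    show "continuous_map (prod_topology ?I Z) (pullback_space Y' f E p) (\<lambda>q. (h q, k q))"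
      unfolding pullback_space_def continuous_map_in_subtopology
      using h k by (auto simp: continuous_map_pairwise o_def)
  qed (use k start in \<open>auto simp: prod_eq_iff\<close>)
qed

lemma fibration_sequence_pullback:
  assumes fib: "fibration_sequence X j E p Y y0"
    and f: "continuous_map Y' Y f" and y0': "y0' \<in> topspace Y'" "f y0' = y0"
  shows "fibration_sequence X (\<lambda>x. (y0', j x)) (pullback_space Y' f E p) fst Y' y0'"
  unfolding fibration_sequence_def
proof (intro conjI)
  have emb: "embedding_map X E j" and im: "j ` topspace X = {e \<in> topspace E. p e = y0}"
    using fib by (auto simp: fibration_sequence_def)
  show "hurewicz_fibration (pullback_space Y' f E p) Y' fst"
    using fib f by (auto simp: fibration_sequence_def intro: hurewicz_fibration_pullback)
  show "y0' \<in> topspace Y'"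
    by (rule y0')
  have jx: "p (j x) = y0" if "x \<in> topspace X" for x
    using im that by blast
  have j: "continuous_map X E j"
    using emb by (simp add: embedding_map_def homeomorphic_eq_everything_map continuous_map_in_subtopology)
  have j': "continuous_map X (pullback_space Y' f E p) (\<lambda>x. (y0', j x))"
    unfolding pullback_space_def
  proof (rule continuous_map_into_subtopology)
    show "continuous_map X (prod_topology Y' E) (\<lambda>x. (y0', j x))"
      using j y0' by (simp add: continuous_map_pairwise o_def)
    show "(\<lambda>x. (y0', j x)) \<in> topspace X \<rightarrow> {(b, e). f b = p e}"
      using jx y0' by auto
  qed
  obtain r where r: "homeomorphic_maps X (subtopology E (j ` topspace X)) j r"
    using emb unfolding embedding_map_def homeomorphic_map_maps by blast
  let ?E' = "subtopology (pullback_space Y' f E p) ((\<lambda>x. (y0', j x)) ` topspace X)"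
  have "continuous_map ?E' (subtopology E (j ` topspace X)) snd"
    unfolding pullback_space_def
    by (auto simp: continuous_map_in_subtopology continuous_map_from_subtopology continuous_map_snd)
  then have "continuous_map ?E' X (r \<circ> snd)"
    using r unfolding homeomorphic_maps_def by (blast intro: continuous_map_compose)
  then have "homeomorphic_maps X ?E' (\<lambda>x. (y0', j x)) (r \<circ> snd)"
    using r j' by (auto simp: homeomorphic_maps_def continuous_map_in_subtopology)
  then show "embedding_map X (pullback_space Y' f E p) (\<lambda>x. (y0', j x))"
    unfolding embedding_map_def homeomorphic_map_maps by blast
  show "(\<lambda>x. (y0', j x)) ` topspace X = {e \<in> topspace (pullback_space Y' f E p). fst e = y0'}"
  proof -
    have "(\<lambda>x. (y0', j x)) ` topspace X = Pair y0' ` {e \<in> topspace E. p e = y0}"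
      unfolding im[symmetric] by (simp add: image_image)
    then show ?thesis
      using y0' by (auto simp: topspace_pullback_space)
  qed
qed

lemma continuous_map_fibre_restriction:
  assumes fib: "fibration_sequence X j E p Y y0"
  shows "continuous_map (aut1_over E p) (aut1 X) (fibre_restriction X j)"
proof -
  have emb: "embedding_map X E j" and im: "j ` topspace X = {e \<in> topspace E. p e = y0}"
    using fib by (auto simp: fibration_sequence_def)
  let ?F = "subtopology E (j ` topspace X)"
  obtain r where r: "homeomorphic_maps X ?F j r"
    using emb unfolding embedding_map_def homeomorphic_map_maps by blast
  have contj: "continuous_map X E j" and contr: "continuous_map ?F X r"
    and rj: "\<And>x. x \<in> topspace X \<Longrightarrow> r (j x) = x"
    using r by (auto simp: homeomorphic_maps_def continuous_map_in_subtopology)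
  have inj: "inj_on j (topspace X)"
    using rj by (metis inj_on_inverseI)
  have jX: "j x \<in> topspace E" "p (j x) = y0" if "x \<in> topspace X" for x
    using im that by blast+
  have Fj: "g (j x) \<in> j ` topspace X"
    if "continuous_map E E g" "over_base E p g" "x \<in> topspace X" for g x
  proof -
    have "g (j x) \<in> topspace E"
      using that jX continuous_map_funspace by blast
    then show ?thesis
      using that jX unfolding im over_base_def by simp
  qed
  have inv: "inv_into (topspace X) j e = r e" if "e \<in> j ` topspace X" for e
    using that rj inj by (metis image_iff inv_into_f_f)
  have res: "fibre_restriction X j g x = r (g (j x))"
    if "continuous_map E E g" "over_base E p g" "x \<in> topspace X" for g x
    using Fj[OF that] inv that by (simp add: fibre_restriction_def)
  have cont_res: "continuous_map X X (r \<circ> g \<circ> j)"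
    if "continuous_map E E g" "over_base E p g" for g
  proof -
    have "continuous_map X ?F (g \<circ> j)"
    proof (rule continuous_map_into_subtopology)
      show "continuous_map X E (g \<circ> j)"
        using contj that continuous_map_compose by blast
      show "g \<circ> j \<in> topspace X \<rightarrow> j ` topspace X"
        using Fj that by auto
    qed
    then show ?thesis
      using contr continuous_map_compose by (metis comp_assoc)
  qed
  have hom_res: "homotopic_with (\<lambda>_. True) X X (r \<circ> g \<circ> j) (r \<circ> h \<circ> j)"
    if hom: "homotopic_with (over_base E p) E E g h" for g h
  proof -
    let ?I = "top_of_set {0..1::real}"
    obtain k where k: "continuous_map (prod_topology ?I E) E k" "\<And>x. k (0, x) = g x"
      "\<And>x. k (1, x) = h x" "\<And>t. t \<in> {0..1} \<Longrightarrow> over_base E p (\<lambda>x. k (t, x))"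
      using hom unfolding homotopic_with_def by blast
    let ?k = "\<lambda>(t, x). k (t, j x)"
    have "continuous_map (prod_topology ?I X) (prod_topology ?I E) (\<lambda>(t, x). (t, j x))"
      by (auto simp: continuous_map_pairwise o_def case_prod_unfold continuous_map_fst
          intro!: continuous_map_compose[OF continuous_map_snd contj, unfolded o_def])
    from continuous_map_compose[OF this k(1)]
    have kE: "continuous_map (prod_topology ?I X) E ?k"
      by (simp add: o_def case_prod_unfold)
    have "continuous_map (prod_topology ?I X) ?F ?k"
    proof (rule continuous_map_into_subtopology[OF kE], rule funcsetI)
      fix q assume q: "q \<in> topspace (prod_topology ?I X)"
      have "?k q \<in> topspace E"
        using kE q continuous_map_funspace by blast
      moreover have "p (?k q) = y0"
        using q k(4) jX by (auto simp: over_base_def)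
      ultimately show "?k q \<in> j ` topspace X"
        unfolding im by blast
    qed
    then have "continuous_map (prod_topology ?I X) X (r \<circ> ?k)"
      using contr continuous_map_compose by blast
    then show ?thesis
      unfolding homotopic_with_def using k(2,3) by (intro exI[of _ "r \<circ> ?k"]) auto
  qed
  have over: "continuous_map E E g" "over_base E p g" if "g \<in> topspace (aut_over E p)" for g
    using that by (auto simp: aut_over_def topspace_mapping_space)
  have equivalence: "\<exists>h. continuous_map X X h \<and>
      homotopic_with (\<lambda>_. True) X X (h \<circ> fibre_restriction X j g) id \<and>
      homotopic_with (\<lambda>_. True) X X (fibre_restriction X j g \<circ> h) id"
    if g: "g \<in> topspace (aut_over E p)" for g
  proof -
    obtain h where h: "continuous_map E E h" "over_base E p h"
      "homotopic_with (over_base E p) E E (h \<circ> g) id"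
      "homotopic_with (over_base E p) E E (g \<circ> h) id"
      using g unfolding aut_over_def by auto
    note g = over[OF g]
    have jr: "j (r e) = e" if "e \<in> j ` topspace X" for e
      using that rj by auto
    have id: "homotopic_with (\<lambda>_. True) X X (r \<circ> id \<circ> j) id"
      by (rule homotopic_with_equal) (use cont_res[of id] rj in \<open>auto simp: over_base_def\<close>)
    have c: "continuous_map X X (r \<circ> (u \<circ> v) \<circ> j)"
      if "continuous_map E E u" "over_base E p u" "continuous_map E E v" "over_base E p v" for u v
    proof (rule cont_res)
      show "continuous_map E E (u \<circ> v)"
        using that continuous_map_compose by blast
      show "over_base E p (u \<circ> v)"
        using that continuous_map_funspace[OF that(3)] by (auto simp: over_base_def Pi_iff)
    qed
    have 1: "homotopic_with (\<lambda>_. True) X X (r \<circ> (h \<circ> g) \<circ> j) ((r \<circ> h \<circ> j) \<circ> fibre_restriction X j g)"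
      by (rule homotopic_with_equal[OF _ _ c[OF h(1,2) g]]) (use res[OF g] jr Fj[OF g] in auto)
    have rhj: "r (h (j x)) \<in> topspace X" if "x \<in> topspace X" for x
      using cont_res[OF h(1,2)] that by (auto simp: continuous_map_def)
    have 2: "homotopic_with (\<lambda>_. True) X X (r \<circ> (g \<circ> h) \<circ> j) (fibre_restriction X j g \<circ> (r \<circ> h \<circ> j))"
      by (rule homotopic_with_equal[OF _ _ c[OF g h(1,2)]])
        (use res[OF g] jr Fj[OF h(1,2)] rhj in auto)
    show ?thesis
      using homotopic_with_trans[OF homotopic_with_symD[OF 1] homotopic_with_trans[OF hom_res[OF h(3)] id]]
        homotopic_with_trans[OF homotopic_with_symD[OF 2] homotopic_with_trans[OF hom_res[OF h(4)] id]]
        cont_res[OF h(1,2)] by blast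
  qed
  have maps: "fibre_restriction X j g \<in> topspace (mapping_space X X)"
    if "g \<in> topspace (aut_over E p)" for g
  proof -
    have "continuous_map X X (fibre_restriction X j g)"
      by (rule continuous_map_eq[OF cont_res[OF over[OF that]]]) (simp add: res[OF over[OF that]])
    then show ?thesis
      by (simp add: topspace_mapping_space fibre_restriction_def)
  qed
  have "continuous_map (aut_over E p) (mapping_space X X) (fibre_restriction X j)"
    unfolding mapping_space_def
  proof (rule continuous_on_generated_topo)
    fix W
    assume "W \<in> {{f \<in> extensional (topspace X). continuous_map X X f \<and> f ` K \<subseteq> U} | K U.
        compactin X K \<and> openin X U}"
    then obtain K U where K: "compactin X K" and U: "openin X U"
      and W: "W = {f \<in> extensional (topspace X). continuous_map X X f \<and> f ` K \<subseteq> U}"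
      by blast
    have KX: "K \<subseteq> topspace X"
      using K compactin_subset_topspace by blast
    have "openin ?F {e \<in> topspace ?F. r e \<in> U}"
      using contr U openin_continuous_map_preimage by blast
    then obtain V where V: "openin E V" "{e \<in> topspace ?F. r e \<in> U} = V \<inter> j ` topspace X"
      unfolding openin_subtopology by blast
    have VU: "e \<in> V \<longleftrightarrow> r e \<in> U" if "e \<in> j ` topspace X" for e
      using V(2) that im by auto
    have jK: "compactin E (j ` K)"
      using K contj image_compactin by blast
    let ?W = "{f \<in> extensional (topspace E). continuous_map E E f \<and> f ` j ` K \<subseteq> V}"
    have "openin (mapping_space E E) ?W"
      unfolding mapping_space_def
      by (rule topology_generated_by_Basis) (use jK V(1) in blast)
    then have "openin (aut_over E p) (topspace (aut_over E p) \<inter> ?W)"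
      unfolding aut_over_def by (auto simp: openin_subtopology)
    moreover have "fibre_restriction X j -` W \<inter> topspace (aut_over E p) = topspace (aut_over E p) \<inter> ?W"
    proof -
      have "fibre_restriction X j g \<in> W \<longleftrightarrow> g \<in> ?W" if g: "g \<in> topspace (aut_over E p)" for g
      proof -
        have "g \<in> ?W \<longleftrightarrow> (\<forall>x\<in>K. g (j x) \<in> V)"
          using g by (auto simp: aut_over_def topspace_mapping_space)
        also have "\<dots> \<longleftrightarrow> (\<forall>x\<in>K. fibre_restriction X j g x \<in> U)"
          using VU Fj[OF over[OF g]] res[OF over[OF g]] KX by (metis subsetD)
        also have "\<dots> \<longleftrightarrow> fibre_restriction X j g \<in> W"
          using maps[OF g] by (auto simp: W topspace_mapping_space)
        finally show ?thesis
          by blast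
      qed
      then show ?thesis
        by blast
    qed
    ultimately show "openin (aut_over E p) (fibre_restriction X j -` W \<inter> topspace (aut_over E p))"
      by simp
  next
    show "fibre_restriction X j ` topspace (aut_over E p) \<subseteq>
        \<Union> {{f \<in> extensional (topspace X). continuous_map X X f \<and> f ` K \<subseteq> U} | K U.
          compactin X K \<and> openin X U}"
      unfolding topology_generated_by_topspace[symmetric] mapping_space_def[symmetric]
      using maps by blast
  qed
  then have aut: "continuous_map (aut_over E p) (aut X) (fibre_restriction X j)"
    unfolding aut_def by (rule continuous_map_into_subtopology) (use equivalence in auto)
  have id: "fibre_restriction X j (id_map E) = id_map X"
    using jX inj by (auto simp: fibre_restriction_def fun_eq_iff)
  show ?thesis
    unfolding aut1_def aut1_over_def
  proof (rule continuous_map_into_subtopology)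
    show "continuous_map (subtopology (aut_over E p) (Collect (path_component_of (aut_over E p) (id_map E))))
        (aut X) (fibre_restriction X j)"
      using aut by (rule continuous_map_from_subtopology)
    show "fibre_restriction X j \<in> topspace (subtopology (aut_over E p)
        (Collect (path_component_of (aut_over E p) (id_map E)))) \<rightarrow>
        Collect (path_component_of (aut X) (id_map X))"
      using path_component_of_continuous_image[OF aut, of "id_map E"] by (simp add: id)
  qed
qed

lemma continuous_map_evaluation:
  assumes "x0 \<in> topspace X"
  shows "continuous_map (aut1 X) X (evaluation x0)"
proof -
  have "continuous_map (mapping_space X X) X (evaluation x0)"
    unfolding continuous_map_def
  proof (intro conjI allI impI)
    show "evaluation x0 \<in> topspace (mapping_space X X) \<rightarrow> topspace X"
      using assms by (auto simp: evaluation_def topspace_mapping_space continuous_map_def)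
  next
    fix U assume U: "openin X U"
    have "{f \<in> topspace (mapping_space X X). evaluation x0 f \<in> U} =
        {f \<in> extensional (topspace X). continuous_map X X f \<and> f ` {x0} \<subseteq> U}"
      by (auto simp: evaluation_def topspace_mapping_space)
    moreover have "compactin X {x0}"
      using assms by simp
    then have "openin (mapping_space X X)
        {f \<in> extensional (topspace X). continuous_map X X f \<and> f ` {x0} \<subseteq> U}"
      unfolding mapping_space_def by (intro topology_generated_by_Basis) (use U in blast)
    ultimately show "openin (mapping_space X X) {f \<in> topspace (mapping_space X X). evaluation x0 f \<in> U}"
      by simp
  qed
  then show ?thesis
    unfolding aut1_def aut_def by (intro continuous_map_from_subtopology)
qed

end

theory Submission
  imports Defs
begin

text \<open>Pulling back along \<^term>\<open>f\<close> turns a fibrewise self-map \<^term>\<open>g\<close> of \<^term>\<open>E\<close> into the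
  fibrewise self-map \<open>(b, e) \<mapsto> (b, g e)\<close> of the pull-back. This defines a continuous map from
  \<open>aut\<^sub>1(p)\<close> to \<open>aut\<^sub>1(p')\<close> which does not change the restriction to the common fibre, so
  \<open>ev \<circ> R\<close> factors through \<open>ev \<circ> R'\<close> and the images on homotopy groups are nested. Continuity for
  the compact-open topologies needs only that evaluation is continuous on compact subsets of
  \<^term>\<open>E\<close>, which are regular because \<^term>\<open>E\<close> is Hausdorff.\<close>

section \<open>Compact-open topologies\<close>

text \<open>Evaluation may fail to be continuous on a space that is not locally compact, hence the
  restriction to \<open>L\<close>. As a compact Hausdorff space \<open>L\<close> is regular, so a
  point \<open>x\<close> with \<open>g x\<close> in \<open>U\<close> has a closed neighbourhood
  \<open>N\<close> in \<open>L\<close> that \<open>g\<close> maps into \<open>U\<close>. This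
  \<open>N\<close> is compact, so it defines a subbasic open set of maps around
  \<open>g\<close>.\<close>

lemma continuous_map_evaluation_on_compactin:
  assumes X: "Hausdorff_space X" and L: "compactin X L"
  shows "continuous_map (prod_topology (mapping_space X Y) (subtopology X L)) Y (\<lambda>(g, x). g x)"
  unfolding continuous_map_def
proof (intro conjI allI impI)
  let ?P = "prod_topology (mapping_space X Y) (subtopology X L)"
  show "(\<lambda>(g, x). g x) \<in> topspace ?P \<rightarrow> topspace Y"
    by (auto simp: topspace_mapping_space continuous_map_def)
  fix U assume U: "openin Y U"
  show "openin ?P {q \<in> topspace ?P. (case q of (g, x) \<Rightarrow> g x) \<in> U}"
  proof (rule openin_subopen[THEN iffD2], clarify)
    fix g x assume gx: "(g, x) \<in> topspace ?P" and "g x \<in> U"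
    have g: "continuous_map X Y g" "g \<in> extensional (topspace X)" and x: "x \<in> topspace (subtopology X L)"
      using gx by (auto simp: topspace_mapping_space)
    have "compact_space (subtopology X L)" "Hausdorff_space (subtopology X L)"
      using L X by (auto simp: compact_space_subtopology Hausdorff_space_subtopology)
    then have "neighbourhood_base_of (closedin (subtopology X L)) (subtopology X L)"
      by (simp add: neighbourhood_base_of_closedin compact_Hausdorff_imp_regular_space)
    then have basis: "\<exists>T N. openin (subtopology X L) T \<and> closedin (subtopology X L) N \<and>
        x \<in> T \<and> T \<subseteq> N \<and> N \<subseteq> V" if "openin (subtopology X L) V" "x \<in> V" for V
      using that unfolding neighbourhood_base_of by simp
    let ?V = "{x \<in> topspace (subtopology X L). g x \<in> U}"
    have "openin (subtopology X L) ?V"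
      using g U by (intro openin_continuous_map_preimage[of _ Y] continuous_map_from_subtopology)
    moreover have "x \<in> ?V"
      using x \<open>g x \<in> U\<close> by simp
    ultimately obtain T N where T: "openin (subtopology X L) T" "x \<in> T" "T \<subseteq> N"
      and N: "closedin (subtopology X L) N" "N \<subseteq> ?V"
      using basis[of ?V] by metis
    have "compactin (subtopology X L) N"
      using N(1) \<open>compact_space (subtopology X L)\<close> closedin_compact_space by blast
    then have K: "compactin X N"
      by (simp add: compactin_subtopology)
    let ?W = "{h \<in> extensional (topspace X). continuous_map X Y h \<and> h ` N \<subseteq> U}"
    have "openin (mapping_space X Y) ?W"
      unfolding mapping_space_def by (rule topology_generated_by_Basis) (use K U in blast)
    then have "openin ?P (?W \<times> T)"
      using T by (simp add: openin_prod_Times_iff)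
    moreover have "(g, x) \<in> ?W \<times> T"
      using g N T by auto
    moreover have "?W \<times> T \<subseteq> {q \<in> topspace ?P. (case q of (g, x) \<Rightarrow> g x) \<in> U}"
      using openin_subset[OF T(1)] T(3) by (auto simp: topspace_mapping_space image_subset_iff)
    ultimately show "\<exists>T. openin ?P T \<and> (g, x) \<in> T \<and>
        T \<subseteq> {q \<in> topspace ?P. (case q of (g, x) \<Rightarrow> g x) \<in> U}"
      by (intro exI[of _ "?W \<times> T"] conjI)
  qed
qed

text \<open>A subbasic open set tests maps on a single compact \<open>K\<close>, so continuity of
  \<open>F\<close> can be checked after restriction to \<open>K\<close>, where it follows by
  currying. Continuity on compact subsets does not in general give continuity of \<open>F a\<close>
  on all of \<open>X\<close>; that is why \<open>F\<close> is assumed to take values in the mapping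
  space.\<close>

lemma continuous_map_into_mapping_space:
  assumes F: "F ` topspace A \<subseteq> topspace (mapping_space X Y)"
    and cont: "\<And>K. compactin X K \<Longrightarrow>
      continuous_map (prod_topology A (subtopology X K)) Y (\<lambda>(a, x). F a x)"
  shows "continuous_map A (mapping_space X Y) F"
  unfolding mapping_space_def
proof (rule continuous_on_generated_topo)
  fix W
  assume "W \<in> {{f \<in> extensional (topspace X). continuous_map X Y f \<and> f ` K \<subseteq> U} | K U.
      compactin X K \<and> openin Y U}"
  then obtain K U where K: "compactin X K" and U: "openin Y U"
    and W: "W = {f \<in> extensional (topspace X). continuous_map X Y f \<and> f ` K \<subseteq> U}"
    by blast
  let ?K = "subtopology X K"
  have top: "topspace ?K = K"
    using compactin_subset_topspace[OF K] by (simp add: inf_absorb2)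
  have KK: "compactin ?K K"
    using K by (simp add: compactin_subtopology)
  let ?W = "{f \<in> extensional (topspace ?K). continuous_map ?K Y f \<and> f ` K \<subseteq> U}"
  let ?F = "\<lambda>a. \<lambda>x\<in>topspace ?K. F a x"
  have curry: "continuous_map A (mapping_space ?K Y) ?F"
    using continuous_map_curry[OF cont[OF K]] by simp
  have "openin (mapping_space ?K Y) ?W"
    unfolding mapping_space_def by (rule topology_generated_by_Basis) (use KK U in blast)
  then have "openin A {a \<in> topspace A. ?F a \<in> ?W}"
    using curry by (rule openin_continuous_map_preimage[rotated])
  \<comment> \<open>Both sides reduce to the condition that \<open>F a\<close> maps \<open>K\<close>
    into \<open>U\<close>, since extensionality and continuity are already known for
    \<open>F a\<close> and for its restriction.\<close>
  moreover have "{a \<in> topspace A. ?F a \<in> ?W} = F -` W \<inter> topspace A"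
  proof -
    have "?F a \<in> ?W \<longleftrightarrow> F a \<in> W" if "a \<in> topspace A" for a
    proof -
      have "?F a \<in> topspace (mapping_space ?K Y)"
        using curry that by (auto simp: continuous_map_def)
      moreover have "F a \<in> topspace (mapping_space X Y)"
        using F that by blast
      ultimately show ?thesis
        using compactin_subset_topspace[OF K]
        by (auto simp: topspace_mapping_space W top image_subset_iff subset_iff)
    qed
    then show ?thesis
      by blast
  qed
  ultimately show "openin A (F -` W \<inter> topspace A)"
    by simp
next
  show "F ` topspace A \<subseteq> \<Union> {{f \<in> extensional (topspace X). continuous_map X Y f \<and> f ` K \<subseteq> U} | K U.
      compactin X K \<and> openin Y U}"
    using F unfolding topology_generated_by_topspace[symmetric] mapping_space_def .
qed

section \<open>Pulling back fibrewise self-maps\<close>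

text \<open>The parameter space \<open>A\<close> is left arbitrary to cover both single maps (a
  point) and homotopies (the interval). Since each \<open>k (a, _)\<close> preserves
  \<open>p\<close>, the pair \<open>(b, k (a, e))\<close> stays in the pull-back.\<close>

lemma continuous_map_pullback_self_map:
  assumes k: "continuous_map (prod_topology A E) E k"
    and over: "\<And>a e. a \<in> topspace A \<Longrightarrow> e \<in> topspace E \<Longrightarrow> p (k (a, e)) = p e"
  shows "continuous_map (prod_topology A (pullback_space B f E p)) (pullback_space B f E p)
    (\<lambda>(a, b, e). (b, k (a, e)))"
proof -
  let ?P = "pullback_space B f E p"
  have proj: "continuous_map ?P B fst" "continuous_map ?P E snd"
    unfolding pullback_space_def
    by (auto intro: continuous_map_from_subtopology continuous_map_fst continuous_map_snd)
  have "continuous_map (prod_topology A ?P) (prod_topology A E) (\<lambda>q. (fst q, snd (snd q)))"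
    using continuous_map_compose[OF continuous_map_snd proj(2)]
    by (auto simp: continuous_map_pairwise o_def continuous_map_fst)
  from continuous_map_compose[OF this k]
  have "continuous_map (prod_topology A ?P) E (\<lambda>q. k (fst q, snd (snd q)))"
    by (simp add: o_def)
  moreover have "continuous_map (prod_topology A ?P) B (\<lambda>q. fst (snd q))"
    using continuous_map_compose[OF continuous_map_snd proj(1)] by (simp add: o_def)
  ultimately have "continuous_map (prod_topology A ?P) (prod_topology B E) (\<lambda>(a, b, e). (b, k (a, e)))"
    by (simp add: continuous_map_pairwise o_def case_prod_unfold)
  then show ?thesis
    unfolding pullback_space_def
    by (rule continuous_map_into_subtopology[of _ "prod_topology B E", folded pullback_space_def])
      (use over in \<open>auto simp: topspace_pullback_space\<close>)
qed

lemma continuous_map_map_prod_pullback: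
  assumes g: "continuous_map E E g" and over: "over_base E p g"
  shows "continuous_map (pullback_space B f E p) (pullback_space B f E p) (map_prod id g)"
proof -
  \<comment> \<open>The one-point parameter space \<open>?A\<close> reduces the claim to the
    parametrised version.\<close>
  let ?P = "pullback_space B f E p" and ?A = "top_of_set {0::real}"
  have "continuous_map (prod_topology ?A E) E (\<lambda>(a, e). g e)"
    using continuous_map_compose[OF continuous_map_snd g] by (simp add: o_def case_prod_unfold)
  then have "continuous_map (prod_topology ?A ?P) ?P (\<lambda>(a, b, e). (b, g e))"
    using continuous_map_pullback_self_map[of ?A E "\<lambda>(a, e). g e" p B f] over
    by (simp add: over_base_def)
  moreover have "continuous_map ?P (prod_topology ?A ?P) (\<lambda>q. (0, q))"
    by (simp add: continuous_map_pairwise o_def)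
  ultimately have "continuous_map ?P ?P ((\<lambda>(a, b, e). (b, g e)) \<circ> (\<lambda>q. (0::real, q)))"
    by (rule continuous_map_compose[rotated])
  then show ?thesis
    by (simp add: o_def map_prod_def case_prod_unfold)
qed

lemma over_base_map_prod_pullback: "over_base (pullback_space B f E p) fst (map_prod id g)"
  by (simp add: over_base_def)

text \<open>With the interval as parameter space, a fibrewise homotopy pulls back to one that fixes
  the base coordinate at every time. Hence fibre-homotopy inverses pull back to fibre-homotopy
  inverses.\<close>

lemma homotopic_with_map_prod_pullback:
  assumes "homotopic_with (over_base E p) E E u v"
  shows "homotopic_with (over_base (pullback_space B f E p) fst)
    (pullback_space B f E p) (pullback_space B f E p) (map_prod id u) (map_prod id v)"
proof -
  let ?I = "top_of_set {0..1::real}"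
  obtain k where k: "continuous_map (prod_topology ?I E) E k" "\<And>x. k (0, x) = u x"
    "\<And>x. k (1, x) = v x" "\<And>t. t \<in> {0..1} \<Longrightarrow> over_base E p (\<lambda>x. k (t, x))"
    using assms unfolding homotopic_with_def by blast
  have "continuous_map (prod_topology ?I (pullback_space B f E p)) (pullback_space B f E p)
      (\<lambda>(t, b, e). (b, k (t, e)))"
    using k by (intro continuous_map_pullback_self_map) (auto simp: over_base_def)
  then show ?thesis
    unfolding homotopic_with_def
    by (intro exI[of _ "\<lambda>(t, b, e). (b, k (t, e))"])
      (use k in \<open>auto simp: over_base_def\<close>)
qed

text \<open>The restriction is there because the points of \<open>mapping_space\<close> are
  extensional functions.\<close>

definition pullback_self_map ::
    "'b topology \<Rightarrow> ('b \<Rightarrow> 'y) \<Rightarrow> 'e topology \<Rightarrow> ('e \<Rightarrow> 'y) \<Rightarrow> ('e \<Rightarrow> 'e) \<Rightarrow> 'b \<times> 'e \<Rightarrow> 'b \<times> 'e" where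
  "pullback_self_map B f E p g = restrict (map_prod id g) (topspace (pullback_space B f E p))"

lemma pullback_self_map_id:
  "pullback_self_map B f E p (id_map E) = id_map (pullback_space B f E p)"
  by (auto simp: pullback_self_map_def topspace_pullback_space fun_eq_iff)

text \<open>A compact \<open>K\<close> in the pull-back projects to a compact subset of the
  Hausdorff space \<open>E\<close>, where evaluation is jointly continuous. So
  \<open>(g, (b, e)) \<mapsto> (b, g e)\<close> is continuous on the product of
  \<open>aut_over E p\<close> with \<open>K\<close>, which suffices for the compact-open
  topology.\<close>

lemma continuous_map_pullback_self_map_aut_over:
  assumes E: "Hausdorff_space E"
  shows "continuous_map (aut_over E p) (aut_over (pullback_space B f E p) fst)
    (pullback_self_map B f E p)"
proof -
  let ?P = "pullback_space B f E p" and ?\<Phi> = "pullback_self_map B f E p"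
  have over: "continuous_map E E g" "over_base E p g" if "g \<in> topspace (aut_over E p)" for g
    using that by (auto simp: aut_over_def topspace_mapping_space)
  have \<Phi>_cont: "continuous_map ?P ?P (?\<Phi> g)" if "g \<in> topspace (aut_over E p)" for g
    by (rule continuous_map_eq[OF continuous_map_map_prod_pullback[OF over[OF that]]])
      (simp add: pullback_self_map_def)
  have \<Phi>_over: "over_base ?P fst (?\<Phi> g)" for g
    by (simp add: over_base_def pullback_self_map_def)
  have equivalence: "\<exists>h. continuous_map ?P ?P h \<and> over_base ?P fst h \<and>
      homotopic_with (over_base ?P fst) ?P ?P (h \<circ> ?\<Phi> g) id \<and>
      homotopic_with (over_base ?P fst) ?P ?P (?\<Phi> g \<circ> h) id"
    if g: "g \<in> topspace (aut_over E p)" for g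
  proof -
    obtain h where h: "continuous_map E E h" "over_base E p h"
      "homotopic_with (over_base E p) E E (h \<circ> g) id"
      "homotopic_with (over_base E p) E E (g \<circ> h) id"
      using g unfolding aut_over_def by auto
    \<comment> \<open>A homotopy inverse in \<open>aut_over\<close> need not be extensional, so the
      unrestricted product map serves.\<close>
    let ?h = "map_prod id h :: 'b \<times> 'a \<Rightarrow> 'b \<times> 'a"
    have hP: "continuous_map ?P ?P ?h"
      using h by (intro continuous_map_map_prod_pullback)
    have 1: "homotopic_with (over_base ?P fst) ?P ?P (?h \<circ> ?\<Phi> g) id"
      by (rule homotopic_with_eq[OF homotopic_with_map_prod_pullback[OF h(3)]])
        (auto simp: pullback_self_map_def over_base_def)
    \<comment> \<open>In the other composite \<open>?\<Phi> g\<close> is applied to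
      \<open>?h q\<close>, and it agrees with \<open>map_prod id g\<close> there only because this
      point lies in \<open>?P\<close>.\<close>
    have hq: "?h q \<in> topspace ?P" if "q \<in> topspace ?P" for q
      using hP that by (auto simp: continuous_map_def)
    have 2: "homotopic_with (over_base ?P fst) ?P ?P (?\<Phi> g \<circ> ?h) id"
      by (rule homotopic_with_eq[OF homotopic_with_map_prod_pullback[OF h(4)]])
        (use hq in \<open>auto simp: pullback_self_map_def over_base_def\<close>)
    show ?thesis
      using hP 1 2 over_base_map_prod_pullback by blast
  qed
  have "continuous_map (aut_over E p) (mapping_space ?P ?P) ?\<Phi>"
  proof (rule continuous_map_into_mapping_space)
    show "?\<Phi> ` topspace (aut_over E p) \<subseteq> topspace (mapping_space ?P ?P)"
      using \<Phi>_cont by (auto simp: topspace_mapping_space pullback_self_map_def)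
  next
    fix K assume K: "compactin ?P K"
    let ?A = "aut_over E p" and ?L = "subtopology E (snd ` K)"
    have KP: "K \<subseteq> topspace ?P"
      using K compactin_subset_topspace by blast
    have "continuous_map ?P E snd"
      unfolding pullback_space_def
      by (intro continuous_map_from_subtopology continuous_map_snd)
    then have L: "compactin E (snd ` K)"
      using K image_compactin by blast
    \<comment> \<open>The inclusion into the full mapping space, along which joint evaluation is
      pulled back to \<open>?A\<close>.\<close>
    have "continuous_map ?A (mapping_space E E) id"
      unfolding aut_over_def by (simp add: continuous_map_from_subtopology)
    from continuous_map_compose[OF continuous_map_fst this]
    have "continuous_map (prod_topology ?A ?L) (prod_topology (mapping_space E E) ?L) id"
      by (simp add: continuous_map_pairwise o_def continuous_map_snd)
    from continuous_map_compose[OF this continuous_map_evaluation_on_compactin[OF E L]]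
    have ev: "continuous_map (prod_topology ?A ?L) E (\<lambda>(g, e). g e)"
      by simp
    have "continuous_map (subtopology ?P K) ?L snd"
      using \<open>continuous_map ?P E snd\<close>
      by (auto simp: continuous_map_in_subtopology intro: continuous_map_from_subtopology)
    from continuous_map_compose[OF continuous_map_snd this]
    have "continuous_map (prod_topology ?A (subtopology ?P K)) (prod_topology ?A ?L)
        (\<lambda>q. (fst q, snd (snd q)))"
      by (simp add: continuous_map_pairwise o_def continuous_map_fst)
    from continuous_map_compose[OF this ev]
    have toE: "continuous_map (prod_topology ?A (subtopology ?P K)) E (\<lambda>q. fst q (snd (snd q)))"
      by (simp add: o_def)
    have "continuous_map (subtopology ?P K) B fst"
      unfolding pullback_space_def by (intro continuous_map_from_subtopology continuous_map_fst)
    from continuous_map_compose[OF continuous_map_snd this]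
    have toB: "continuous_map (prod_topology ?A (subtopology ?P K)) B (\<lambda>q. fst (snd q))"
      by (simp add: o_def)
    have "continuous_map (prod_topology ?A (subtopology ?P K)) ?P
        (\<lambda>q. (fst (snd q), fst q (snd (snd q))))"
      unfolding pullback_space_def[of B f E p]
    proof (rule continuous_map_into_subtopology, fold pullback_space_def)
      show "continuous_map (prod_topology ?A (subtopology ?P K)) (prod_topology B E)
          (\<lambda>q. (fst (snd q), fst q (snd (snd q))))"
        using toE toB by (simp add: continuous_map_pairwise o_def)
      show "(\<lambda>q. (fst (snd q), fst q (snd (snd q)))) \<in>
          topspace (prod_topology ?A (subtopology ?P K)) \<rightarrow> {(b, e). f b = p e}"
        using over by (auto simp: over_base_def topspace_pullback_space)
    qed
    then show "continuous_map (prod_topology ?A (subtopology ?P K)) ?P (\<lambda>(g, q). ?\<Phi> g q)"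
      by (rule continuous_map_eq) (auto simp: pullback_self_map_def)
  qed
  then show ?thesis
    unfolding aut_over_def[of ?P]
    by (rule continuous_map_into_subtopology) (use equivalence \<Phi>_over in auto)
qed

text \<open>The identity pulls back to the identity, so a path from it to \<open>g\<close> is
  carried to a path from the identity of the pull-back, and identity components correspond.\<close>

lemma continuous_map_pullback_self_map_aut1_over:
  assumes "Hausdorff_space E"
  shows "continuous_map (aut1_over E p) (aut1_over (pullback_space B f E p) fst)
    (pullback_self_map B f E p)"
proof -
  note cont = continuous_map_pullback_self_map_aut_over[OF assms, of p B f]
  show ?thesis
    unfolding aut1_over_def
  proof (rule continuous_map_into_subtopology[OF continuous_map_from_subtopology[OF cont]])
    show "pullback_self_map B f E p \<in> topspace (subtopology (aut_over E p)
        (Collect (path_component_of (aut_over E p) (id_map E)))) \<rightarrow>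
        Collect (path_component_of (aut_over (pullback_space B f E p) fst)
          (id_map (pullback_space B f E p)))"
      using path_component_of_continuous_image[OF cont, of "id_map E"]
      by (simp add: pullback_self_map_id)
  qed
qed

section \<open>Homotopy groups\<close>

lemma spheroid_compose:
  assumes "continuous_map A B \<phi>" "\<phi> a = b" "spheroid n A a s"
  shows "spheroid n B b (\<phi> \<circ> s)"
  using assms continuous_map_compose[of "cube n" A s B \<phi>]
  by (simp add: spheroid_def sends_boundary_def)

text \<open>The induced map is a union over all representatives of a class. Composing with
  \<open>\<phi>\<close> preserves homotopies relative to the boundary, so all members of this union
  coincide and one representative suffices.\<close>

lemma homotopy_group_map_spheroid_class:
  assumes \<phi>: "continuous_map A B \<phi>" "\<phi> a = b" and s: "spheroid n A a s"
  shows "homotopy_group_map n B b \<phi> (spheroid_class n A a s) = spheroid_class n B b (\<phi> \<circ> s)"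
proof -
  have comp: "homotopic_with (sends_boundary n b) (cube n) B (\<phi> \<circ> s) (\<phi> \<circ> t)"
    if "homotopic_with (sends_boundary n a) (cube n) A s t" for t
    using homotopic_with_compose_continuous_map_left[OF that \<phi>(1)] \<phi>(2)
    by (simp add: sends_boundary_def)
  have "s \<in> spheroid_class n A a s"
    using s by (simp add: spheroid_class_def spheroid_def)
  moreover have "spheroid_class n B b (\<phi> \<circ> t) = spheroid_class n B b (\<phi> \<circ> s)"
    if "t \<in> spheroid_class n A a s" for t
    using comp[of t] that unfolding spheroid_class_def
    by (blast intro: homotopic_with_trans homotopic_with_symD)
  ultimately show ?thesis
    unfolding homotopy_group_map_def by blast
qed

section \<open>Comparison of the evaluation maps of the two fibrations\<close>

lemma fibre_restriction_id_map:
  assumes "fibration_sequence X j E p Y y0" "x \<in> topspace X"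
  shows "fibre_restriction X j (id_map E) x = x"
proof -
  have emb: "embedding_map X E j" and im: "j ` topspace X = {e \<in> topspace E. p e = y0}"
    using assms by (auto simp: fibration_sequence_def)
  have "inj_on j (topspace X)"
    using emb by (simp add: embedding_map_def homeomorphic_eq_everything_map)
  moreover have "j x \<in> topspace E"
    using im assms(2) by blast
  ultimately show ?thesis
    using assms(2) by (simp add: fibre_restriction_def)
qed

theorem proposition1p5:
  fixes X :: "'x topology" and E :: "'e topology" and Y :: "'y topology" and Y' :: "'b topology"
    and j :: "'x \<Rightarrow> 'e" and p :: "'e \<Rightarrow> 'y" and f :: "'b \<Rightarrow> 'y"
    and x0 :: 'x and y0 :: 'y and y0' :: 'b and n :: nat
  assumes "fibration_sequence X j E p Y y0"
    and "CW_complex X" and "CW_complex E" and "CW_complex Y"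
    and "x0 \<in> topspace X"
    and "continuous_map Y' Y f" and "y0' \<in> topspace Y'" and "f y0' = y0"
    and "n > 0"
  shows "fibre_restricted_gottlieb n X x0 j E p
           \<subseteq> fibre_restricted_gottlieb n X x0 (\<lambda>x. (y0', j x)) (pullback_space Y' f E p) fst"
proof -
  let ?P = "pullback_space Y' f E p" and ?j = "\<lambda>x. (y0', j x)"
  let ?\<Phi> = "pullback_self_map Y' f E p"
  let ?\<omega> = "evaluation x0 \<circ> fibre_restriction X j" and ?\<omega>' = "evaluation x0 \<circ> fibre_restriction X ?j"
  have fib': "fibration_sequence X ?j ?P fst Y' y0'"
    using assms by (intro fibration_sequence_pullback)
  have E: "Hausdorff_space E"
    using assms by (auto simp: CW_complex_def CW_structure_def)
  have jx0: "j x0 \<in> topspace E" "p (j x0) = y0"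
    using assms by (auto simp: fibration_sequence_def)
  have \<omega>: "continuous_map (aut1_over E p) X ?\<omega>" "?\<omega> (id_map E) = x0"
    using continuous_map_compose[OF continuous_map_fibre_restriction[OF assms(1)]
        continuous_map_evaluation[OF assms(5)]] fibre_restriction_id_map[OF assms(1,5)]
    by (simp_all add: evaluation_def)
  have \<omega>': "continuous_map (aut1_over ?P fst) X ?\<omega>'" "?\<omega>' (id_map ?P) = x0"
    using continuous_map_compose[OF continuous_map_fibre_restriction[OF fib']
        continuous_map_evaluation[OF assms(5)]] fibre_restriction_id_map[OF fib' assms(5)]
    by (simp_all add: evaluation_def)
  \<comment> \<open>The pulled-back map sends \<open>(y0', j x0)\<close> to
    \<open>(y0', g (j x0))\<close>. Unfolding \<open>inv_into\<close> shows that the inverses of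
    \<open>?j\<close> and \<open>j\<close> choose by equivalent predicates, so the equation holds
    for every function \<open>g\<close>, not only for points of
    \<open>aut1_over E p\<close>.\<close>
  have factor: "?\<omega>' \<circ> ?\<Phi> = ?\<omega>"
    using assms(5,7,8) jx0
    by (simp add: fun_eq_iff evaluation_def fibre_restriction_def pullback_self_map_def
        topspace_pullback_space inv_into_def)
  have \<Phi>: "continuous_map (aut1_over E p) (aut1_over ?P fst) ?\<Phi>"
    by (rule continuous_map_pullback_self_map_aut1_over[OF E])
  show ?thesis
    unfolding fibre_restricted_gottlieb_def homotopy_group_def partial_object.simps
  proof (intro image_subsetI, elim imageE CollectE, clarify)
    fix s assume s: "spheroid n (aut1_over E p) (id_map E) s"
    \<comment> \<open>The class of \<open>?\<Phi> \<circ> s\<close> is the witness: by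
      \<open>factor\<close> its image under \<open>?\<omega>'\<close> is the image of the class of
      \<open>s\<close> under \<open>?\<omega>\<close>.\<close>
    have s': "spheroid n (aut1_over ?P fst) (id_map ?P) (?\<Phi> \<circ> s)"
      using \<Phi> pullback_self_map_id s by (rule spheroid_compose)
    have "homotopy_group_map n X x0 ?\<omega> (spheroid_class n (aut1_over E p) (id_map E) s) =
        spheroid_class n X x0 (?\<omega>' \<circ> (?\<Phi> \<circ> s))"
      using homotopy_group_map_spheroid_class[OF \<omega> s] by (simp only: factor[symmetric] o_assoc)
    also have "\<dots> = homotopy_group_map n X x0 ?\<omega>'
        (spheroid_class n (aut1_over ?P fst) (id_map ?P) (?\<Phi> \<circ> s))"
      by (rule homotopy_group_map_spheroid_class[OF \<omega>' s', symmetric])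
    finally show "homotopy_group_map n X x0 ?\<omega> (spheroid_class n (aut1_over E p) (id_map E) s) \<in>
        homotopy_group_map n X x0 ?\<omega>' ` spheroid_class n (aut1_over ?P fst) (id_map ?P) `
          Collect (spheroid n (aut1_over ?P fst) (id_map ?P))"
      using s' by blast
  qed
qed

end
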